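(* Let $\mathbb{K}$ be an algebraically closed field, let $A$ be an affine space over $\mathbb{K}$ with coordinate ring identified with a polynomial ring $\mathbb{K}[A]=\mathbb{K}[x_i : i\in N]$ for a finite index set $N$, and fix a term order on this ring. Suppose $\mathcal{T}$ is a transition system of pairs of ideals of $\mathbb{K}[A]$. Then $\operatorname{init}(I)=J$ for all $(I,J)\in\mathcal{T}$.
   Context: A term order on $\mathbb{K}[A]$ is a total order on the set of all monomials such that $1$ is the unique minimum and $\mathsf{m}_1\le \mathsf{m}_2$ implies $\mathsf{m}_1\mathsf{m}_3\le \mathsf{m}_2\mathsf{m}_3$. For $f\neq 0$, $\operatorname{init}(f)$ is the maximal monomial occurring in $f$ with nonzero coefficient (without its coefficient), and $\operatorname{init}(0)=0$. For an ideal $I$, $\operatorname{init}(I)$ is the $\mathbb{K}$-span of $\{\operatorname{init}(f): f\in I\}$, which is a monomial ideal (an ideal generated by monomials). For an ideal $I$ and $0\ne f\in\mathbb{K}[A]$ let $(I:\langle f\rangle)=\{g\in\mathbb{K}[A]: fg\in I\}$. Definition (transition system). Let $\mathcal{T}$ be a set of pairs $(I,J)$ where $I$ and $J$ are proper ideals of $\mathbb{K}[A]$ such that: (T1) for each $(I,J)\in\mathcal{T}$, $J$ is a monomial ideal contained in $\operatorname{init}(I)$, with $J=\operatorname{init}(I)$ if $I$ is maximal; (T2) if $(I,J),(I',J')\in\mathcal{T}$ have $I=I'$ then $J=J'$. The set $\mathcal{T}$ is a transition system if for each $(I,J)\in\mathcal{T}$ where $I$ is neither maximal nor equal to $J$,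 there exist a non-constant $f\in\mathbb{K}[A]$ with $f\notin I$ and a nonempty finite set $\Phi\subseteq\mathcal{T}$ such that: (T3) $I+\langle f\rangle\subseteq\bigcap_{(P,Q)\in\Phi}P$ and $J+\langle\operatorname{init}(f)\rangle=\bigcap_{(P,Q)\in\Phi}Q$; (T4) if $I':=(I:\langle f\rangle)$ is not equal to $I$ and $J':=(J:\langle\operatorname{init}(f)\rangle)$, then $(I',J')\in\mathcal{T}$. *)

theory Defs
  imports
    "HOL-Algebra.Ideal"
    "HOL-Library.Poly_Mapping"
    "HOL-Computational_Algebra.Polynomial"
begin

text \<open>
  A monomial is its exponent vector, a finitely supported map from variables to exponents, so
  multiplication of monomials is addition of exponent vectors and the monomial 1 is the vector 0.
  A polynomial is a finitely supported map from monomials to coefficients.  The index set of the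
  variables is an explicit set \<open>N\<close>, not a type, so that it may be empty.
\<close>

type_synonym 'v monomial = "'v \<Rightarrow>\<^sub>0 nat"
type_synonym ('v, 'k) mpoly = "'v monomial \<Rightarrow>\<^sub>0 'k"

definition monomials :: "'v set \<Rightarrow> 'v monomial set" where
  "monomials N = {m. Poly_Mapping.keys m \<subseteq> N}"

definition mpoly_ring :: "'v set \<Rightarrow> ('v, 'k::comm_ring_1) mpoly ring" where
  "mpoly_ring N =
    \<lparr>carrier = {p. Poly_Mapping.keys p \<subseteq> monomials N},
     monoid.mult = (*), one = 1, zero = 0, add = (+)\<rparr>"

definition monom_poly :: "'v monomial \<Rightarrow> ('v, 'k::comm_ring_1) mpoly" where
  "monom_poly m = Poly_Mapping.single m 1"

definition const_poly :: "'k \<Rightarrow> ('v, 'k::comm_ring_1) mpoly" where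
  "const_poly c = Poly_Mapping.single 0 c"

definition scale_poly :: "'k \<Rightarrow> ('v, 'k::comm_ring_1) mpoly \<Rightarrow> ('v, 'k) mpoly" where
  "scale_poly c p = const_poly c * p"

lemma cring_mpoly_ring: "cring (mpoly_ring N :: ('v, 'k::comm_ring_1) mpoly ring)"
proof -
  have keys0: "Poly_Mapping.keys m1 \<subseteq> N \<Longrightarrow> Poly_Mapping.keys m2 \<subseteq> N \<Longrightarrow>
      Poly_Mapping.keys (m1 + m2) \<subseteq> N" for m1 m2 :: "'v monomial"
    using Poly_Mapping.keys_add[of m1 m2] by blast
  have mult: "Poly_Mapping.keys (p * q) \<subseteq> monomials N"
    if "Poly_Mapping.keys p \<subseteq> monomials N" "Poly_Mapping.keys q \<subseteq> monomials N"
    for p q :: "('v, 'k) mpoly"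
    using Poly_Mapping.keys_mult[of p q] that keys0 unfolding monomials_def by blast
  have add: "Poly_Mapping.keys (p + q) \<subseteq> monomials N"
    if "Poly_Mapping.keys p \<subseteq> monomials N" "Poly_Mapping.keys q \<subseteq> monomials N"
    for p q :: "('v, 'k) mpoly"
    using Poly_Mapping.keys_add[of p q] that by blast
  have zero: "0 \<in> monomials N"
    by (simp add: monomials_def)
  show ?thesis
  proof (intro cringI abelian_groupI comm_monoidI)
    fix p assume "p \<in> carrier (mpoly_ring N :: ('v, 'k) mpoly ring)"
    then show "\<exists>q\<in>carrier (mpoly_ring N). q \<oplus>\<^bsub>mpoly_ring N\<^esub> p = \<zero>\<^bsub>mpoly_ring N\<^esub>"
      by (intro bexI[of _ "- p"]) (simp_all add: mpoly_ring_def)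
  qed (auto simp: mpoly_ring_def zero algebra_simps
        dest: subsetD[OF mult] subsetD[OF add])
qed

lemma vector_space_scale_poly:
  "vector_space (scale_poly :: 'k::field \<Rightarrow> ('v, 'k) mpoly \<Rightarrow> ('v, 'k) mpoly)"
  by unfold_locales
    (simp_all add: scale_poly_def const_poly_def algebra_simps single_add mult_single
      flip: mult.assoc)

definition term_order :: "'v set \<Rightarrow> 'v monomial rel \<Rightarrow> bool" where
  "term_order N r \<longleftrightarrow>
    linear_order_on (monomials N) r \<and>
    (\<forall>m\<in>monomials N. (0, m) \<in> r) \<and>
    (\<forall>m1\<in>monomials N. \<forall>m2\<in>monomials N. \<forall>m3\<in>monomials N.
       (m1, m2) \<in> r \<longrightarrow> (m1 + m3, m2 + m3) \<in> r)"

definition init :: "'v monomial rel \<Rightarrow> ('v, 'k::comm_ring_1) mpoly \<Rightarrow> ('v, 'k) mpoly" where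
  "init r f =
    (if f = 0 then 0
     else monom_poly
       (THE m. m \<in> Poly_Mapping.keys f \<and> (\<forall>m'\<in>Poly_Mapping.keys f. (m', m) \<in> r)))"

definition init_ideal :: "'v monomial rel \<Rightarrow> ('v, 'k::field) mpoly set \<Rightarrow> ('v, 'k) mpoly set" where
  "init_ideal r I = module.span scale_poly (init r ` I)"

definition monomial_ideal :: "'v set \<Rightarrow> ('v, 'k::comm_ring_1) mpoly set \<Rightarrow> bool" where
  "monomial_ideal N J \<longleftrightarrow> (\<exists>S\<subseteq>monomials N. J = Idl\<^bsub>mpoly_ring N\<^esub> (monom_poly ` S))"

definition ideal_colon ::
  "'v set \<Rightarrow> ('v, 'k::comm_ring_1) mpoly set \<Rightarrow> ('v, 'k) mpoly \<Rightarrow> ('v, 'k) mpoly set" where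
  "ideal_colon N I f = {g \<in> carrier (mpoly_ring N). f * g \<in> I}"

definition proper_ideal :: "'v set \<Rightarrow> ('v, 'k::comm_ring_1) mpoly set \<Rightarrow> bool" where
  "proper_ideal N I \<longleftrightarrow> ideal I (mpoly_ring N) \<and> I \<noteq> carrier (mpoly_ring N)"

definition transition_system ::
  "'v set \<Rightarrow> 'v monomial rel \<Rightarrow> (('v, 'k::field) mpoly set \<times> ('v, 'k) mpoly set) set \<Rightarrow> bool"
where
  "transition_system N r T \<longleftrightarrow>
    (\<forall>(I, J)\<in>T. proper_ideal N I \<and> proper_ideal N J) \<and>
    (\<forall>(I, J)\<in>T. monomial_ideal N J \<and> J \<subseteq> init_ideal r I \<and>
       (maximalideal I (mpoly_ring N) \<longrightarrow> J = init_ideal r I)) \<and>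
    (\<forall>(I, J)\<in>T. \<forall>(I', J')\<in>T. I = I' \<longrightarrow> J = J') \<and>
    (\<forall>(I, J)\<in>T. \<not> maximalideal I (mpoly_ring N) \<and> I \<noteq> J \<longrightarrow>
       (\<exists>f\<in>carrier (mpoly_ring N). \<exists>\<Phi>.
          f \<notin> range const_poly \<and> f \<notin> I \<and>
          \<Phi> \<noteq> {} \<and> finite \<Phi> \<and> \<Phi> \<subseteq> T \<and>
          I <+>\<^bsub>mpoly_ring N\<^esub> Idl\<^bsub>mpoly_ring N\<^esub> {f} \<subseteq> (\<Inter>(P, Q)\<in>\<Phi>. P) \<and>
          J <+>\<^bsub>mpoly_ring N\<^esub> Idl\<^bsub>mpoly_ring N\<^esub> {init r f} = (\<Inter>(P, Q)\<in>\<Phi>. Q) \<and>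
          (ideal_colon N I f \<noteq> I \<longrightarrow>
             (ideal_colon N I f, ideal_colon N J (init r f)) \<in> T)))"

end

theory Submission
  imports Defs
begin

text \<open>
  The ideals \<open>init I\<close> and \<open>J\<close> are spanned by monomials, so it suffices to compare monomials.  By
  Noetherian induction on \<open>I\<close> the claim holds for the pairs in \<open>\<Phi>\<close>, so (T3) gives
  \<open>init (I + \<langle>f\<rangle>) \<subseteq> J + \<langle>t\<rangle>\<close> where \<open>t = init f\<close>.  If \<open>init I \<noteq> J\<close>, take \<open>g \<in> I\<close> whose initial
  monomial \<open>m\<close> is minimal outside \<open>J\<close>; then \<open>m = n t\<close> for some \<open>n\<close>.  Cancel \<open>m\<close> against a multiple of
  \<open>n f\<close> and divide by \<open>I\<close> and \<open>f\<close> below \<open>m\<close>.  This yields \<open>v + u f \<in> I\<close> where no monomial of \<open>v\<close> is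
  in \<open>J + \<langle>t\<rangle>\<close> and no monomial \<open>k\<close> of \<open>u \<noteq> 0\<close> satisfies \<open>k t \<in> J\<close> or \<open>k t > m\<close>.  As \<open>v \<in> I + \<langle>f\<rangle>\<close>,
  it vanishes, so \<open>u \<in> (I : f)\<close>.  The monomial \<open>k = init u\<close> contradicts the induction hypothesis for
  \<open>(I : f)\<close> if that ideal differs from \<open>I\<close>, and the minimality of \<open>m\<close> if it equals \<open>I\<close>, because
  then \<open>k < k t \<le> m\<close> and \<open>k \<in> init I\<close>.  No Hilbert function is involved, so the term order need not
  refine the degree.
\<close>

section \<open>Leading monomials and coefficients\<close>

definition lead_monom :: "'v monomial rel \<Rightarrow> ('v, 'k::zero) mpoly \<Rightarrow> 'v monomial" where
  "lead_monom r f =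
    (THE m. m \<in> Poly_Mapping.keys f \<and> (\<forall>m'\<in>Poly_Mapping.keys f. (m', m) \<in> r))"

text \<open>Zero is removed because \<open>THE\<close> leaves \<open>lead_monom r 0\<close>
  unspecified.\<close>

definition lead_monoms :: "'v monomial rel \<Rightarrow> ('v, 'k::zero) mpoly set \<Rightarrow> 'v monomial set" where
  "lead_monoms r I = lead_monom r ` (I - {0})"

definition monoms_in :: "('v, 'k::comm_ring_1) mpoly set \<Rightarrow> 'v monomial set" where
  "monoms_in J = {m. monom_poly m \<in> J}"

lemma init_eq_lead_monom: "init r f = (if f = 0 then 0 else monom_poly (lead_monom r f))"
  by (simp add: init_def lead_monom_def)

text \<open>Addition of exponent vectors is cancellative, so only the pair \<open>n\<close>,
  \<open>k\<close> can contribute to the convolution at \<open>n + k\<close>.\<close>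

lemma lookup_single_times:
  fixes f :: "('v, 'k::comm_ring_1) mpoly"
  shows "Poly_Mapping.lookup (Poly_Mapping.single n c * f) (n + k) = c * Poly_Mapping.lookup f k"
proof -
  have "Sum_any (\<lambda>l. (c when n = l) * Sum_any (\<lambda>q. Poly_Mapping.lookup f q when n + k = l + q))
      = Sum_any (\<lambda>l. c * Sum_any (\<lambda>q. Poly_Mapping.lookup f q when n + k = l + q) when l = n)"
    by (rule Sum_any.cong) (auto simp: when_def)
  then show ?thesis
    by (simp add: lookup_mult lookup_single)
qed

lemma lookup_scale_poly [simp]:
  fixes f :: "('v, 'k::comm_ring_1) mpoly"
  shows "Poly_Mapping.lookup (scale_poly c f) k = c * Poly_Mapping.lookup f k"
  using lookup_single_times[of 0 c f k] by (simp add: scale_poly_def const_poly_def)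

lemma keys_single_times_subset:
  fixes f :: "('v, 'k::comm_ring_1) mpoly"
  shows "Poly_Mapping.keys (Poly_Mapping.single n c * f) \<subseteq> (+) n ` Poly_Mapping.keys f"
  using keys_mult[of "Poly_Mapping.single n c" f] by (auto split: if_splits)

lemma monom_poly_nonzero [simp]: "(monom_poly m :: ('v, 'k::comm_ring_1) mpoly) \<noteq> 0"
proof -
  have "Poly_Mapping.keys (monom_poly m :: ('v, 'k) mpoly) = {m}" by (simp add: monom_poly_def)
  then show ?thesis by auto
qed

text \<open>Reduces membership of a polynomial in a span or an ideal to membership of its
  monomials.\<close>

lemma poly_eq_sum_scaled_monoms:
  fixes p :: "('v, 'k::comm_ring_1) mpoly"
  shows "p = (\<Sum>k\<in>Poly_Mapping.keys p. scale_poly (Poly_Mapping.lookup p k) (monom_poly k))"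
  by (rule poly_mapping_eqI)
    (simp add: lookup_sum monom_poly_def lookup_single when_def in_keys_iff
      if_distrib[of "\<lambda>x. _ * x"] cong: if_cong)

section \<open>Dickson's lemma\<close>

text \<open>One variable is treated at a time: every sequence of natural numbers has a nondecreasing
  subsequence, and passing to a further subsequence keeps the earlier variables monotone.\<close>

lemma dickson_subseq:
  fixes s :: "nat \<Rightarrow> 'v monomial"
  assumes "finite N"
  shows "\<exists>h. strict_mono h \<and>
    (\<forall>v\<in>N. incseq (\<lambda>i. Poly_Mapping.lookup (s (h i)) v))"
  using assms
proof (induction N)
  case empty
  show ?case by (rule exI[of _ "\<lambda>i. i"]) (simp add: strict_mono_def)
next
  case (insert v N)
  then obtain h where h: "strict_mono h"
    "\<forall>v\<in>N. incseq (\<lambda>i. Poly_Mapping.lookup (s (h i)) v)" by blast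
  define x where "x i = Poly_Mapping.lookup (s (h i)) v" for i
  \<comment> \<open>Enumerate indices whose value is minimal among all later values.\<close>
  have "\<exists>g. strict_mono g \<and> incseq (x \<circ> g)"
  proof -
    have ex: "\<exists>n\<ge>k. \<forall>m\<ge>n. x n \<le> x m" for k
    proof -
      obtain n where "n \<ge> k" "\<forall>m. m \<ge> k \<longrightarrow> x n \<le> x m"
        using ex_has_least_nat[of "\<lambda>n. n \<ge> k" k x] by auto
      then show ?thesis by (meson order_trans)
    qed
    define nx where "nx k = (SOME n. n \<ge> k \<and> (\<forall>m\<ge>n. x n \<le> x m))" for k
    have nx: "nx k \<ge> k" "m \<ge> nx k \<Longrightarrow> x (nx k) \<le> x m" for k m
      using someI_ex[OF ex[of k]] unfolding nx_def by blast+
    define g where "g = rec_nat (nx 0) (\<lambda>_ a. nx (Suc a))"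
    have g: "g 0 = nx 0" "g (Suc n) = nx (Suc (g n))" for n by (simp_all add: g_def)
    have mono: "strict_mono g"
      unfolding strict_mono_Suc_iff g using nx(1) Suc_le_lessD by blast
    \<comment> \<open>For both forms of \<open>n\<close>, \<open>g n\<close> is \<open>nx\<close> of
      the argument given by the case expression, so \<open>x (g n)\<close> bounds all later values
      from below.\<close>
    have "x (g n) \<le> x (g (Suc n))" for n
      using nx(2)[of "case n of 0 \<Rightarrow> 0 | Suc i \<Rightarrow> Suc (g i)" "g (Suc n)"]
        strict_monoD[OF mono, of n "Suc n"]
      by (cases n) (simp_all add: g)
    then have "incseq (x \<circ> g)" by (simp add: incseq_Suc_iff)
    with mono show ?thesis by blast
  qed
  then obtain g where g: "strict_mono g" "incseq (x \<circ> g)" by blast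
  have "incseq (\<lambda>i. Poly_Mapping.lookup (s (h (g i))) u)" if "u \<in> N" for u
    using h(2) that g(1) unfolding incseq_def by (meson strict_mono_less_eq)
  moreover have "incseq (\<lambda>i. Poly_Mapping.lookup (s (h (g i))) v)"
    using g(2) by (simp add: x_def comp_def)
  ultimately show ?case
    using strict_mono_o[OF h(1) g(1)] by (intro exI[of _ "h \<circ> g"]) (auto simp: comp_def)
qed

lemma dickson:
  fixes s :: "nat \<Rightarrow> 'v monomial"
  assumes "finite N" and "\<And>i. s i \<in> monomials N"
  shows "\<exists>i j d. i < j \<and> d \<in> monomials N \<and> s j = d + s i"
proof -
  obtain h where h: "strict_mono h" "\<forall>v\<in>N. incseq (\<lambda>i. Poly_Mapping.lookup (s (h i)) v)"
    using dickson_subseq[OF assms(1)] by blast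
  let ?i = "h 0" and ?j = "h 1"
  have le: "Poly_Mapping.lookup (s ?i) v \<le> Poly_Mapping.lookup (s ?j) v" for v
  proof (cases "v \<in> N")
    case True
    then show ?thesis using h(2) by (auto simp: incseq_def)
  next
    case False
    then have "v \<notin> Poly_Mapping.keys (s ?i)" using assms(2) by (auto simp: monomials_def)
    then show ?thesis by (simp add: in_keys_iff)
  qed
  \<comment> \<open>Subtraction of exponents is truncated; \<open>le\<close> makes it exact
    here.\<close>
  have "s ?j = (s ?j - s ?i) + s ?i"
    using le by (intro poly_mapping_eqI) (simp add: lookup_add lookup_minus del: One_nat_def)
  moreover have "s ?j - s ?i \<in> monomials N"
    using assms(2)[of ?j] unfolding monomials_def by (auto simp: in_keys_iff lookup_minus subset_iff)
  moreover have "?i < ?j" using h(1) by (simp add: strict_mono_def)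
  ultimately show ?thesis by blast
qed

section \<open>The polynomial ring and its ideals\<close>

lemma zero_in_monomials [simp]: "0 \<in> monomials N"
  by (simp add: monomials_def)

lemma add_in_monomials [simp]:
  "m \<in> monomials N \<Longrightarrow> n \<in> monomials N \<Longrightarrow> m + n \<in> monomials N"
  using keys_add[of m n] by (auto simp: monomials_def)

lemma mem_carrier_mpoly_ring:
  "p \<in> carrier (mpoly_ring N) \<longleftrightarrow> Poly_Mapping.keys p \<subseteq> monomials N"
  by (simp add: mpoly_ring_def)

lemma single_in_carrier:
  "m \<in> monomials N \<Longrightarrow> Poly_Mapping.single m c \<in> carrier (mpoly_ring N)"
  by (simp add: mem_carrier_mpoly_ring)

lemma monom_poly_in_carrier:
  "monom_poly m \<in> (carrier (mpoly_ring N) :: ('v, 'k::comm_ring_1) mpoly set) \<longleftrightarrow> m \<in> monomials N"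
  by (simp add: monom_poly_def mem_carrier_mpoly_ring)

lemma carrier_closed:
  fixes p q :: "('v, 'k::comm_ring_1) mpoly"
  assumes "p \<in> carrier (mpoly_ring N)" "q \<in> carrier (mpoly_ring N)"
  shows "p + q \<in> carrier (mpoly_ring N)" "p - q \<in> carrier (mpoly_ring N)"
    "p * q \<in> carrier (mpoly_ring N)"
proof -
  interpret R: cring "mpoly_ring N :: ('v, 'k) mpoly ring" by (rule cring_mpoly_ring)
  show "p + q \<in> carrier (mpoly_ring N)" using R.a_closed[OF assms] by (simp add: mpoly_ring_def)
  show "p * q \<in> carrier (mpoly_ring N)" using R.m_closed[OF assms] by (simp add: mpoly_ring_def)
  show "p - q \<in> carrier (mpoly_ring N)"
    using assms keys_diff[of p q] by (auto simp: mem_carrier_mpoly_ring)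
qed

text \<open>Restates closure under the operations of the ring record for the type class operations,
  in which all later computations are done.\<close>

lemma ideal_closed:
  fixes I :: "('v, 'k::comm_ring_1) mpoly set"
  assumes "ideal I (mpoly_ring N)"
  shows "I \<subseteq> carrier (mpoly_ring N)" "0 \<in> I"
    "p \<in> I \<Longrightarrow> q \<in> I \<Longrightarrow> p + q \<in> I"
    "p \<in> I \<Longrightarrow> q \<in> carrier (mpoly_ring N) \<Longrightarrow> q * p \<in> I"
    "p \<in> I \<Longrightarrow> q \<in> I \<Longrightarrow> p - q \<in> I"
proof -
  interpret ideal I "mpoly_ring N" by fact
  show "I \<subseteq> carrier (mpoly_ring N)" using a_subset .
  show "0 \<in> I" using additive_subgroup.zero_closed[OF additive_subgroup_axioms] by (simp add: mpoly_ring_def)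
  show add: "p + q \<in> I" if "p \<in> I" "q \<in> I" for p q
    using additive_subgroup.a_closed[OF additive_subgroup_axioms that] by (simp add: mpoly_ring_def)
  show mult: "q * p \<in> I" if "p \<in> I" "q \<in> carrier (mpoly_ring N)" for p q
    using I_l_closed[OF that] by (simp add: mpoly_ring_def)
  \<comment> \<open>Multiplying by \<open>- 1\<close> gives negatives without the additive inverse
    of the ring record.\<close>
  have "- 1 \<in> (carrier (mpoly_ring N) :: ('v, 'k) mpoly set)"
    by (simp add: mem_carrier_mpoly_ring)
  from mult[OF _ this] add show "p - q \<in> I" if "p \<in> I" "q \<in> I"
    using that by (metis mult_minus1 uminus_add_conv_diff add.commute)
qed

lemma ideal_sum_closed:
  fixes I :: "('v, 'k::comm_ring_1) mpoly set"
  assumes "ideal I (mpoly_ring N)" and "finite A" and "\<And>a. a \<in> A \<Longrightarrow> F a \<in> I"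
  shows "sum F A \<in> I"
  using assms(2,3)
proof (induction A)
  case empty
  show ?case using ideal_closed(2)[OF assms(1)] by simp
next
  case (insert a A)
  then show ?case using ideal_closed(3)[OF assms(1)] by simp
qed

lemma ideal_scale_closed:
  fixes I :: "('v, 'k::comm_ring_1) mpoly set"
  assumes "ideal I (mpoly_ring N)" and "p \<in> I"
  shows "scale_poly c p \<in> I"
  unfolding scale_poly_def const_poly_def
  using assms by (intro ideal_closed(4)) (simp_all add: single_in_carrier)

section \<open>Monomial ideals and initial ideals by their monomials\<close>

text \<open>The polynomials supported on multiples of the generators form an ideal containing the
  generators, hence containing \<open>J\<close>. Conversely, \<open>J\<close> contains these
  multiples, and it contains every linear combination of its monomials.\<close>

lemma monomial_ideal_mem_iff:
  fixes J :: "('v, 'k::comm_ring_1) mpoly set"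
  assumes "monomial_ideal N J"
  shows "p \<in> J \<longleftrightarrow> Poly_Mapping.keys p \<subseteq> monoms_in J"
proof -
  interpret R: cring "mpoly_ring N :: ('v, 'k) mpoly ring" by (rule cring_mpoly_ring)
  obtain S where S: "S \<subseteq> monomials N" and J: "J = Idl\<^bsub>mpoly_ring N\<^esub> (monom_poly ` S)"
    using assms unfolding monomial_ideal_def by blast
  have Sc: "monom_poly ` S \<subseteq> (carrier (mpoly_ring N) :: ('v, 'k) mpoly set)"
    using S by (auto simp: monom_poly_in_carrier)
  have idJ: "ideal J (mpoly_ring N)" unfolding J using R.genideal_ideal[OF Sc] .
  \<comment> \<open>\<open>U\<close> is the set of monomial multiples of generators, and
    \<open>K\<close> is the candidate ideal that is to contain \<open>J\<close>.\<close>
  define U where "U = {n + s | n s. n \<in> monomials N \<and> s \<in> S}"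
  define K :: "('v, 'k) mpoly set" where "K = {p. Poly_Mapping.keys p \<subseteq> U}"
  have U: "n + u \<in> U" if "n \<in> monomials N" "u \<in> U" for n u
    using that unfolding U_def by (auto simp flip: add.assoc) (metis add_in_monomials)
  have UN: "U \<subseteq> monomials N" using S by (auto simp: U_def)
  have mult: "q * p \<in> K" if "p \<in> K" "q \<in> carrier (mpoly_ring N)" for p q
    using keys_mult[of q p] that U unfolding K_def mem_carrier_mpoly_ring by blast
  have "ideal K (mpoly_ring N)"
  proof (rule idealI)
    show "ring (mpoly_ring N :: ('v, 'k) mpoly ring)" by (rule R.ring_axioms)
    have "p + q \<in> K" if "p \<in> K" "q \<in> K" for p q
      using keys_add[of p q] that by (auto simp: K_def)
    moreover have Kc: "K \<subseteq> carrier (mpoly_ring N)"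
      using UN by (auto simp: K_def mem_carrier_mpoly_ring)
    moreover have "\<ominus>\<^bsub>mpoly_ring N\<^esub> p \<in> K" if "p \<in> K" for p
    proof -
      have "\<ominus>\<^bsub>mpoly_ring N\<^esub> p = - p"
        using that Kc
        by (intro R.minus_equality) (auto simp: mpoly_ring_def mem_carrier_mpoly_ring)
      then show ?thesis using that by (simp add: K_def)
    qed
    moreover have "0 \<in> K" by (simp add: K_def)
    ultimately show "subgroup K (add_monoid (mpoly_ring N))"
      by (unfold_locales; simp add: a_inv_def; simp add: mpoly_ring_def)
  next
    fix p q assume *: "p \<in> K" "q \<in> carrier (mpoly_ring N :: ('v, 'k) mpoly ring)"
    show "q \<otimes>\<^bsub>mpoly_ring N\<^esub> p \<in> K" using mult[OF *] by (simp add: mpoly_ring_def)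
    show "p \<otimes>\<^bsub>mpoly_ring N\<^esub> q \<in> K" using mult[OF *] by (simp add: mpoly_ring_def mult.commute)
  qed
  moreover have "monom_poly ` S \<subseteq> K"
    by (auto simp: K_def U_def monom_poly_def) (metis add_0 zero_in_monomials)
  ultimately have JK: "J \<subseteq> K" unfolding J by (rule R.genideal_minimal)
  have "U \<subseteq> monoms_in J"
  proof
    fix u assume "u \<in> U"
    then obtain n s where u: "u = n + s" "n \<in> monomials N" "s \<in> S" unfolding U_def by blast
    have "monom_poly s \<in> J" using R.genideal_self[OF Sc] u(3) unfolding J by blast
    then have "monom_poly n * monom_poly s \<in> J"
      using u(2) by (intro ideal_closed(4)[OF idJ]) (simp_all add: monom_poly_in_carrier)
    then show "u \<in> monoms_in J" by (simp add: monoms_in_def u(1) monom_poly_def mult_single)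
  qed
  then have "Poly_Mapping.keys p \<subseteq> monoms_in J" if "p \<in> J" using that JK by (auto simp: K_def)
  moreover have "p \<in> J" if "Poly_Mapping.keys p \<subseteq> monoms_in J"
    by (subst poly_eq_sum_scaled_monoms)
      (use that in \<open>auto simp: monoms_in_def intro!: ideal_sum_closed[OF idJ] ideal_scale_closed[OF idJ]\<close>)
  ultimately show ?thesis by blast
qed

text \<open>The polynomials supported on a fixed set of monomials form a subspace, and the nonzero
  values of \<open>init r\<close> on \<open>I\<close> are exactly the monomials in
  \<open>lead_monoms r I\<close>.\<close>

lemma init_ideal_mem_iff:
  fixes I :: "('v, 'k::field) mpoly set"
  shows "p \<in> init_ideal r I \<longleftrightarrow> Poly_Mapping.keys p \<subseteq> lead_monoms r I"
proof
  interpret V: vector_space "scale_poly :: 'k \<Rightarrow> ('v, 'k) mpoly \<Rightarrow> ('v, 'k) mpoly"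
    by (rule vector_space_scale_poly)
  have "V.subspace {p. Poly_Mapping.keys p \<subseteq> lead_monoms r I}"
    unfolding V.subspace_def
  proof (intro conjI ballI allI)
    fix p q :: "('v, 'k) mpoly" and c
    assume p: "p \<in> {p. Poly_Mapping.keys p \<subseteq> lead_monoms r I}"
    show "scale_poly c p \<in> {p. Poly_Mapping.keys p \<subseteq> lead_monoms r I}"
      using p by (auto simp: in_keys_iff subset_iff)
    assume "q \<in> {p. Poly_Mapping.keys p \<subseteq> lead_monoms r I}"
    then show "p + q \<in> {p. Poly_Mapping.keys p \<subseteq> lead_monoms r I}"
      using p keys_add[of p q] by blast
  qed simp
  moreover have "init r ` I \<subseteq> {p. Poly_Mapping.keys p \<subseteq> lead_monoms r I}"
    by (auto simp: init_eq_lead_monom monom_poly_def lead_monoms_def)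
  ultimately have "V.span (init r ` I) \<subseteq> {p. Poly_Mapping.keys p \<subseteq> lead_monoms r I}"
    by (intro V.span_minimal)
  then show "Poly_Mapping.keys p \<subseteq> lead_monoms r I" if "p \<in> init_ideal r I"
    using that by (auto simp: init_ideal_def)
  assume p: "Poly_Mapping.keys p \<subseteq> lead_monoms r I"
  have "monom_poly k \<in> init r ` I" if "k \<in> Poly_Mapping.keys p" for k
    using that p unfolding lead_monoms_def image_iff by (force simp: init_eq_lead_monom)
  then show "p \<in> init_ideal r I"
    unfolding init_ideal_def
    by (subst poly_eq_sum_scaled_monoms) (intro V.span_sum V.span_scale V.span_base)
qed

section \<open>Transition systems at a single pair\<close>

lemma transition_systemD:
  fixes T :: "(('v, 'k::field) mpoly set \<times> ('v, 'k) mpoly set) set"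
  assumes "transition_system N r T" and "(I, J) \<in> T"
  shows "ideal I (mpoly_ring N)" "ideal J (mpoly_ring N)" "monomial_ideal N J"
    "J \<subseteq> init_ideal r I" "maximalideal I (mpoly_ring N) \<Longrightarrow> J = init_ideal r I"
    "\<not> maximalideal I (mpoly_ring N) \<Longrightarrow> I \<noteq> J \<Longrightarrow> \<exists>f\<in>carrier (mpoly_ring N). \<exists>\<Phi>.
          f \<notin> range const_poly \<and> f \<notin> I \<and>
          \<Phi> \<noteq> {} \<and> finite \<Phi> \<and> \<Phi> \<subseteq> T \<and>
          I <+>\<^bsub>mpoly_ring N\<^esub> Idl\<^bsub>mpoly_ring N\<^esub> {f} \<subseteq> (\<Inter>(P, Q)\<in>\<Phi>. P) \<and>
          J <+>\<^bsub>mpoly_ring N\<^esub> Idl\<^bsub>mpoly_ring N\<^esub> {init r f} = (\<Inter>(P, Q)\<in>\<Phi>. Q) \<and>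
          (ideal_colon N I f \<noteq> I \<longrightarrow>
             (ideal_colon N I f, ideal_colon N J (init r f)) \<in> T)"
proof -
  note D = assms(1)[unfolded transition_system_def]
  note D1 = bspec[OF conjunct1[OF D] assms(2), unfolded prod.case proper_ideal_def]
  note D2 = bspec[OF conjunct1[OF conjunct2[OF D]] assms(2), unfolded prod.case]
  note D3 = bspec[OF conjunct2[OF conjunct2[OF conjunct2[OF D]]] assms(2), unfolded prod.case]
  show "ideal I (mpoly_ring N)" "ideal J (mpoly_ring N)" using D1 by simp_all
  show "monomial_ideal N J" "J \<subseteq> init_ideal r I"
    "maximalideal I (mpoly_ring N) \<Longrightarrow> J = init_ideal r I" using D2 by simp_all
  assume "\<not> maximalideal I (mpoly_ring N)" "I \<noteq> J"
  then show "\<exists>f\<in>carrier (mpoly_ring N). \<exists>\<Phi>.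
          f \<notin> range const_poly \<and> f \<notin> I \<and>
          \<Phi> \<noteq> {} \<and> finite \<Phi> \<and> \<Phi> \<subseteq> T \<and>
          I <+>\<^bsub>mpoly_ring N\<^esub> Idl\<^bsub>mpoly_ring N\<^esub> {f} \<subseteq> (\<Inter>(P, Q)\<in>\<Phi>. P) \<and>
          J <+>\<^bsub>mpoly_ring N\<^esub> Idl\<^bsub>mpoly_ring N\<^esub> {init r f} = (\<Inter>(P, Q)\<in>\<Phi>. Q) \<and>
          (ideal_colon N I f \<noteq> I \<longrightarrow>
             (ideal_colon N I f, ideal_colon N J (init r f)) \<in> T)" by (rule D3[rule_format, OF conjI])
qed

section \<open>Term orders and leading monomials\<close>

locale term_ordered =
  fixes N :: "'v set" and r :: "'v monomial rel"
  assumes finite_vars: "finite N" and term_order: "term_order N r"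
begin

lemma order_subset: "r \<subseteq> monomials N \<times> monomials N"
  and order_refl: "m \<in> monomials N \<Longrightarrow> (m, m) \<in> r"
  and order_trans: "trans r"
  and order_antisym: "antisym r"
  and order_total: "m \<in> monomials N \<Longrightarrow> n \<in> monomials N \<Longrightarrow> (m, n) \<in> r \<or> (n, m) \<in> r"
  and order_zero: "m \<in> monomials N \<Longrightarrow> (0, m) \<in> r"
proof -
  have lin: "linear_order_on (monomials N) r" using term_order by (simp add: term_order_def)
  then show "r \<subseteq> monomials N \<times> monomials N" "trans r" "antisym r"
    by (auto simp: order_on_defs)
  show refl: "(m, m) \<in> r" if "m \<in> monomials N" for m
    using lin that by (auto simp: order_on_defs dest: refl_onD)
  show "(m, n) \<in> r \<or> (n, m) \<in> r" if "m \<in> monomials N" "n \<in> monomials N" for m n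
    using lin that refl by (cases "m = n") (auto simp: order_on_defs total_on_def)
  show "m \<in> monomials N \<Longrightarrow> (0, m) \<in> r" using term_order by (simp add: term_order_def)
qed

lemma order_add: "(m, n) \<in> r \<Longrightarrow> k \<in> monomials N \<Longrightarrow> (m + k, n + k) \<in> r"
  using term_order order_subset unfolding term_order_def by blast

lemma strict_order_trans: "trans (r - Id)"
  using order_trans order_antisym by (rule trans_diff_Id)

text \<open>In an infinite descending chain, Dickson's lemma finds a term dividing a later one. As 1
  is the minimum, a divisor is never larger than its multiple, which contradicts the
  descent.\<close>

lemma wf_strict_order: "wf (r - Id)"
  unfolding wf_iff_no_infinite_down_chain
proof
  assume "\<exists>s. \<forall>i. (s (Suc i), s i) \<in> r - Id"
  then obtain s where s: "\<And>i. (s (Suc i), s i) \<in> r - Id" by blast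
  have less: "(s j, s i) \<in> r - Id" if "i < j" for i j
    using that by (induction rule: less_Suc_induct) (use s strict_order_trans in \<open>blast dest: transD\<close>)+
  have "s i \<in> monomials N" for i using s[of i] order_subset by blast
  then obtain i j d where ij: "i < j" "d \<in> monomials N" "s j = d + s i" "s i \<in> monomials N"
    using dickson[OF finite_vars, of s] by blast
  then have "(s i, s j) \<in> r" using order_add[OF order_zero, of d "s i"] by simp
  then show False using less[OF ij(1)] order_antisym by (auto dest: antisymD)
qed

lemma lead_monom_eqI:
  "m \<in> Poly_Mapping.keys f \<Longrightarrow> (\<And>k. k \<in> Poly_Mapping.keys f \<Longrightarrow> (k, m) \<in> r) \<Longrightarrow> lead_monom r f = m"
  unfolding lead_monom_def using order_antisym by (intro the_equality) (auto dest: antisymD)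

text \<open>A nonempty finite set of monomials has a maximum in a total order, so the description in
  \<open>lead_monom\<close> is satisfied.\<close>

lemma lead_monom_greatest:
  assumes "f \<in> carrier (mpoly_ring N)" and "f \<noteq> 0"
  shows "lead_monom r f \<in> Poly_Mapping.keys f"
    and "k \<in> Poly_Mapping.keys f \<Longrightarrow> (k, lead_monom r f) \<in> r"
    and "lead_monom r f \<in> monomials N"
proof -
  have "\<exists>m\<in>A. \<forall>k\<in>A. (k, m) \<in> r" if "finite A" "A \<noteq> {}" "A \<subseteq> monomials N" for A
    using that
  proof (induction rule: finite_ne_induct)
    case (singleton x)
    then show ?case using order_refl by auto
  next
    case (insert x A)
    then obtain m where m: "m \<in> A" "\<forall>k\<in>A. (k, m) \<in> r" by auto
    from insert.prems m(1) have "(x, m) \<in> r \<or> (m, x) \<in> r" "(x, x) \<in> r"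
      using order_total order_refl by auto
    then show ?case using m order_trans by (auto dest: transD)
  qed
  from this[of "Poly_Mapping.keys f"] obtain m
    where m: "m \<in> Poly_Mapping.keys f" "\<And>k. k \<in> Poly_Mapping.keys f \<Longrightarrow> (k, m) \<in> r"
    using assms by (auto simp: mem_carrier_mpoly_ring)
  from lead_monom_eqI[OF m] have eq: "lead_monom r f = m" .
  show "lead_monom r f \<in> Poly_Mapping.keys f"
    and "k \<in> Poly_Mapping.keys f \<Longrightarrow> (k, lead_monom r f) \<in> r"
    and "lead_monom r f \<in> monomials N"
    using m assms(1) by (auto simp: eq mem_carrier_mpoly_ring)
qed

lemma lead_monom_monom_poly:
  "m \<in> monomials N \<Longrightarrow> lead_monom r (monom_poly m :: ('v, 'k::comm_ring_1) mpoly) = m"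
  by (rule lead_monom_eqI) (auto simp: monom_poly_def order_refl)

text \<open>Multiplication by a monomial shifts all monomials by \<open>n\<close>, keeps their
  coefficients and respects the order.\<close>

lemma monom_poly_times:
  fixes f :: "('v, 'k::comm_ring_1) mpoly"
  assumes "f \<in> carrier (mpoly_ring N)" and "f \<noteq> 0" and "n \<in> monomials N"
  shows "lead_monom r (monom_poly n * f) = n + lead_monom r f"
    and "monom_poly n * f \<noteq> 0"
    and "monom_poly n * f \<in> carrier (mpoly_ring N)"
proof -
  note lead = lead_monom_greatest[OF assms(1,2)]
  have lead_key: "n + lead_monom r f \<in> Poly_Mapping.keys (monom_poly n * f)"
    using lead(1) by (simp add: in_keys_iff monom_poly_def lookup_single_times)
  then show "monom_poly n * f \<noteq> 0" by auto
  show "monom_poly n * f \<in> carrier (mpoly_ring N)"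
    using assms by (intro carrier_closed) (simp_all add: monom_poly_in_carrier)
  show "lead_monom r (monom_poly n * f) = n + lead_monom r f"
  proof (rule lead_monom_eqI[OF lead_key])
    fix k assume "k \<in> Poly_Mapping.keys (monom_poly n * f)"
    then obtain l where "k = n + l" "l \<in> Poly_Mapping.keys f"
      using keys_single_times_subset[of n 1 f] by (auto simp: monom_poly_def)
    then show "(k, n + lead_monom r f) \<in> r"
      using order_add[OF lead(2) assms(3)] by (simp add: add.commute)
  qed
qed

text \<open>The constant \<open>c\<close> is the quotient of the two leading coefficients. That it
  is nonzero later keeps a quotient polynomial from vanishing.\<close>

lemma lead_monom_cancel:
  fixes p q :: "('v, 'k::field) mpoly"
  assumes "p \<in> carrier (mpoly_ring N)" "p \<noteq> 0" "q \<in> carrier (mpoly_ring N)" "q \<noteq> 0"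
    and "lead_monom r p = lead_monom r q"
  obtains c where "c \<noteq> 0"
    and "p - scale_poly c q \<in> carrier (mpoly_ring N)"
    and "\<And>k. k \<in> Poly_Mapping.keys (p - scale_poly c q) \<Longrightarrow> (k, lead_monom r p) \<in> r - Id"
proof -
  let ?m = "lead_monom r q"
  define c where "c = Poly_Mapping.lookup p ?m / Poly_Mapping.lookup q ?m"
  have nz: "Poly_Mapping.lookup p ?m \<noteq> 0" "Poly_Mapping.lookup q ?m \<noteq> 0"
    using lead_monom_greatest(1)[OF assms(1,2)] lead_monom_greatest(1)[OF assms(3,4)]
    by (simp_all add: assms(5) in_keys_iff)
  have "Poly_Mapping.lookup (p - scale_poly c q) ?m = 0"
    using nz by (simp add: lookup_minus c_def)
  moreover have keys: "k \<in> Poly_Mapping.keys p \<or> k \<in> Poly_Mapping.keys q"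
    if "k \<in> Poly_Mapping.keys (p - scale_poly c q)" for k
    using that by (auto simp: in_keys_iff lookup_minus)
  moreover have "(k, ?m) \<in> r" if "k \<in> Poly_Mapping.keys p \<or> k \<in> Poly_Mapping.keys q" for k
    using that lead_monom_greatest(2)[OF assms(1,2)] lead_monom_greatest(2)[OF assms(3,4)]
    by (auto simp: assms(5))
  ultimately have "(k, lead_monom r p) \<in> r - Id"
    if "k \<in> Poly_Mapping.keys (p - scale_poly c q)" for k
    using that by (auto simp: assms(5) in_keys_iff)
  moreover have "p - scale_poly c q \<in> carrier (mpoly_ring N)"
    using keys assms(1,3) unfolding mem_carrier_mpoly_ring by blast
  moreover have "c \<noteq> 0" using nz by (simp add: c_def)
  ultimately show ?thesis using that by blast
qed

section \<open>The ascending chain condition\<close>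

text \<open>In a strictly ascending chain choose \<open>g i\<close> in
  \<open>F (Suc i) - F i\<close> with minimal leading monomial. By Dickson's lemma the leading
  monomial of some \<open>g i\<close> divides that of a later \<open>g j\<close>. Cancelling it
  gives an element of \<open>F (Suc j) - F j\<close> with a smaller leading monomial.\<close>

lemma wf_ideal_supset:
  "wf {(I', I :: ('v, 'k::field) mpoly set).
    ideal I (mpoly_ring N) \<and> ideal I' (mpoly_ring N) \<and> I \<subset> I'}"
  unfolding wf_iff_no_infinite_down_chain
proof
  assume "\<exists>F. \<forall>i. (F (Suc i), F i) \<in> {(I', I :: ('v, 'k) mpoly set).
    ideal I (mpoly_ring N) \<and> ideal I' (mpoly_ring N) \<and> I \<subset> I'}"
  then obtain F :: "nat \<Rightarrow> ('v, 'k) mpoly set"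
    where F: "\<And>i. ideal (F i) (mpoly_ring N)" "\<And>i. F i \<subset> F (Suc i)" by blast
  have mono: "F i \<subseteq> F j" if "i \<le> j" for i j
    using lift_Suc_mono_le[of F] F(2) that by blast
  have "\<exists>g. g \<in> F (Suc i) - F i \<and>
    (\<forall>h\<in>F (Suc i) - F i. (lead_monom r h, lead_monom r g) \<notin> r - Id)" for i
  proof -
    obtain x where "x \<in> F (Suc i) - F i" using F(2)[of i] by blast
    from wfE_min[OF wf_inv_image[OF wf_strict_order, of "lead_monom r"] this]
    show ?thesis by (metis in_inv_image)
  qed
  then obtain g where g: "\<And>i. g i \<in> F (Suc i) - F i"
    and least: "\<And>i h. h \<in> F (Suc i) - F i \<Longrightarrow> (lead_monom r h, lead_monom r (g i)) \<notin> r - Id"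
    by metis
  have gc: "g i \<in> carrier (mpoly_ring N)" "g i \<noteq> 0" for i
    using g[of i] ideal_closed(1)[OF F(1)[of "Suc i"]] ideal_closed(2)[OF F(1)[of i]] by auto
  obtain i j d where ij: "i < j" "d \<in> monomials N"
    "lead_monom r (g j) = d + lead_monom r (g i)"
    using dickson[OF finite_vars, of "\<lambda>i. lead_monom r (g i)", OF lead_monom_greatest(3)[OF gc]]
    by metis
  define q where "q = monom_poly d * g i"
  note q = monom_poly_times[OF gc[of i] ij(2), folded q_def]
  obtain c where c: "g j - scale_poly c q \<in> carrier (mpoly_ring N)"
    "\<And>k. k \<in> Poly_Mapping.keys (g j - scale_poly c q) \<Longrightarrow> (k, lead_monom r (g j)) \<in> r - Id"
    using lead_monom_cancel[OF gc[of j] q(3,2)] ij(3) q(1) by auto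
  have "q \<in> F (Suc i)" unfolding q_def
    using g[of i] ij(2) by (intro ideal_closed(4)[OF F(1)]) (auto simp: monom_poly_in_carrier)
  \<comment> \<open>Since \<open>i < j\<close>, the multiple of \<open>g i\<close> already lies in
    \<open>F j\<close>, so subtracting it leaves \<open>g j\<close> outside
    \<open>F j\<close>.\<close>
  then have "scale_poly c q \<in> F j" 
    using mono[of "Suc i" j] ij(1) by (intro ideal_scale_closed[OF F(1)]) auto
  then have "scale_poly c q \<in> F j" "scale_poly c q \<in> F (Suc j)" using F(2)[of j] by auto
  then have "g j - scale_poly c q \<in> F (Suc j)" "g j - scale_poly c q \<notin> F j"
    using g[of j] ideal_closed(5)[OF F(1), of "g j" "Suc j" "scale_poly c q"]
      ideal_closed(3)[OF F(1), of "g j - scale_poly c q" j "scale_poly c q"] by auto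
  then have "g j - scale_poly c q \<in> F (Suc j) - F j" by blast
  moreover from this have "g j - scale_poly c q \<noteq> 0" using ideal_closed(2)[OF F(1), of j] by auto
  ultimately show False using least c lead_monom_greatest(1)[OF c(1)] by blast
qed

section \<open>Division by an ideal and a polynomial\<close>

text \<open>The leading monomial of \<open>p\<close> is removed repeatedly: by an element of
  \<open>I\<close> if it lies in \<open>S\<close>, else by a multiple of \<open>f\<close> if
  possible, else by moving it to the remainder \<open>v\<close>. The process stops because the bound
  \<open>a\<close> decreases in a well-founded order.\<close>

lemma division_remainder:
  fixes I :: "('v, 'k::field) mpoly set"
  assumes I: "ideal I (mpoly_ring N)" and S: "S \<subseteq> lead_monoms r I"
    and f: "f \<in> carrier (mpoly_ring N)" "f \<noteq> 0"
    and p: "p \<in> carrier (mpoly_ring N)" "\<And>k. k \<in> Poly_Mapping.keys p \<Longrightarrow> (k, a) \<in> r - Id"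
  shows "\<exists>v\<in>carrier (mpoly_ring N). \<exists>w\<in>carrier (mpoly_ring N).
    p - v - w * f \<in> I \<and>
    (\<forall>k\<in>Poly_Mapping.keys v. k \<notin> S \<and> (\<forall>n\<in>monomials N. k \<noteq> n + lead_monom r f)) \<and>
    (\<forall>k\<in>Poly_Mapping.keys w. k + lead_monom r f \<notin> S \<and> (k + lead_monom r f, a) \<in> r - Id)"
  using p
proof (induction a arbitrary: p rule: wf_induct_rule[OF wf_strict_order])
  case (1 a)
  let ?t = "lead_monom r f"
  show ?case
  proof (cases "p = 0")
    case True
    then show ?thesis using ideal_closed(2)[OF I]
      by (intro bexI[of _ 0]) (auto simp: mem_carrier_mpoly_ring)
  next
    case False
    let ?b = "lead_monom r p"
    note lp = lead_monom_greatest[OF 1(2) False]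
    have ba: "(?b, a) \<in> r - Id" using 1(3) lp(1) by blast
    \<comment> \<open>The step common to the three cases: cancel the leading term of
      \<open>p\<close> with \<open>q\<close> and apply the induction hypothesis with
      \<open>?b\<close> in place of \<open>a\<close>. Each case then only has to supply
      \<open>q\<close> and to account for the subtracted multiple of it.\<close>
    have reduce: thesis
      if q: "q \<in> carrier (mpoly_ring N)" "q \<noteq> 0" "lead_monom r q = ?b"
        and cont: "\<And>c v w. v \<in> carrier (mpoly_ring N) \<Longrightarrow> w \<in> carrier (mpoly_ring N) \<Longrightarrow>
          p - scale_poly c q - v - w * f \<in> I \<Longrightarrow>
          \<forall>k\<in>Poly_Mapping.keys v. k \<notin> S \<and> (\<forall>n\<in>monomials N. k \<noteq> n + ?t) \<Longrightarrow>
          \<forall>k\<in>Poly_Mapping.keys w. k + ?t \<notin> S \<and> (k + ?t, a) \<in> r - Id \<Longrightarrow> thesis"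
      for q thesis
    proof -
      obtain c where c: "p - scale_poly c q \<in> carrier (mpoly_ring N)"
        "\<And>k. k \<in> Poly_Mapping.keys (p - scale_poly c q) \<Longrightarrow> (k, ?b) \<in> r - Id"
        using lead_monom_cancel[OF 1(2) False q(1,2)] q(3) by metis
      have "\<exists>v\<in>carrier (mpoly_ring N). \<exists>w\<in>carrier (mpoly_ring N).
        p - scale_poly c q - v - w * f \<in> I \<and>
        (\<forall>k\<in>Poly_Mapping.keys v. k \<notin> S \<and> (\<forall>n\<in>monomials N. k \<noteq> n + ?t)) \<and>
        (\<forall>k\<in>Poly_Mapping.keys w. k + ?t \<notin> S \<and> (k + ?t, ?b) \<in> r - Id)"
        using c(2) by (rule 1(1)[OF ba c(1)])
      then show thesis
      proof (elim bexE conjE)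
        fix v w
        assume vw: "v \<in> carrier (mpoly_ring N)" "w \<in> carrier (mpoly_ring N)"
          "p - scale_poly c q - v - w * f \<in> I"
          "\<forall>k\<in>Poly_Mapping.keys v. k \<notin> S \<and> (\<forall>n\<in>monomials N. k \<noteq> n + ?t)"
        assume "\<forall>k\<in>Poly_Mapping.keys w. k + ?t \<notin> S \<and> (k + ?t, ?b) \<in> r - Id"
        then have "\<forall>k\<in>Poly_Mapping.keys w. k + ?t \<notin> S \<and> (k + ?t, a) \<in> r - Id"
          using transD[OF strict_order_trans _ ba] by blast
        with vw show thesis by (rule cont)
      qed
    qed
    \<comment> \<open>Testing \<open>S\<close> first ensures that a new monomial \<open>n\<close> of
      the quotient \<open>w\<close> has \<open>n + ?t\<close> outside \<open>S\<close>.\<close>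
    consider (ideal) "?b \<in> S" | (div) n where "?b \<notin> S" "n \<in> monomials N" "?b = n + ?t"
      | (rest) "?b \<notin> S" "\<forall>n\<in>monomials N. ?b \<noteq> n + ?t" by blast
    then show ?thesis
    proof cases
      case ideal
      with S have "?b \<in> lead_monom r ` (I - {0})" unfolding lead_monoms_def by blast
      then obtain q where "?b = lead_monom r q" "q \<in> I - {0}" by (rule imageE)
      then have q: "q \<in> I" "q \<noteq> 0" "lead_monom r q = ?b" by simp_all
      have qc: "q \<in> carrier (mpoly_ring N)" using q(1) ideal_closed(1)[OF I] by blast
      show ?thesis
      proof (rule reduce[of q])
        fix c and v w :: "('v, 'k) mpoly"
        assume vw: "v \<in> carrier (mpoly_ring N)" "w \<in> carrier (mpoly_ring N)"
          "\<forall>k\<in>Poly_Mapping.keys v. k \<notin> S \<and> (\<forall>n\<in>monomials N. k \<noteq> n + ?t)"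
          "\<forall>k\<in>Poly_Mapping.keys w. k + ?t \<notin> S \<and> (k + ?t, a) \<in> r - Id"
        assume "p - scale_poly c q - v - w * f \<in> I"
        from ideal_closed(3)[OF I this ideal_scale_closed[OF I q(1), of c]]
        have "p - v - w * f \<in> I" by (simp add: algebra_simps)
        with vw show ?thesis by blast
      qed (use q qc in simp_all)
    next
      case (div n)
      let ?q = "monom_poly n * f"
      note q = monom_poly_times[OF f div(2)]
      show ?thesis
      proof (rule reduce[of ?q])
        fix c and v w :: "('v, 'k) mpoly"
        assume v: "v \<in> carrier (mpoly_ring N)"
          "\<forall>k\<in>Poly_Mapping.keys v. k \<notin> S \<and> (\<forall>n\<in>monomials N. k \<noteq> n + ?t)"
        assume w: "w \<in> carrier (mpoly_ring N)"
          "\<forall>k\<in>Poly_Mapping.keys w. k + ?t \<notin> S \<and> (k + ?t, a) \<in> r - Id"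
        assume I: "p - scale_poly c ?q - v - w * f \<in> I"
        let ?w = "w + Poly_Mapping.single n c"
        have "scale_poly c ?q = Poly_Mapping.single n c * f"
          by (simp add: scale_poly_def const_poly_def monom_poly_def mult_single flip: mult.assoc)
        with I have "p - v - ?w * f \<in> I" by (simp add: algebra_simps)
        moreover have "?w \<in> carrier (mpoly_ring N)"
          using w(1) div(2) by (intro carrier_closed single_in_carrier)
        moreover have "\<forall>k\<in>Poly_Mapping.keys ?w. k + ?t \<notin> S \<and> (k + ?t, a) \<in> r - Id"
          using keys_add[of w "Poly_Mapping.single n c"] w(2) div(1) ba
          by (auto simp: div(3) split: if_splits)
        ultimately show ?thesis using v by blast
      qed (use q div in auto)
    next
      case rest
      let ?q = "monom_poly ?b :: ('v, 'k) mpoly"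
      show ?thesis
      proof (rule reduce[of ?q])
        fix c and v w :: "('v, 'k) mpoly"
        assume v: "v \<in> carrier (mpoly_ring N)"
          "\<forall>k\<in>Poly_Mapping.keys v. k \<notin> S \<and> (\<forall>n\<in>monomials N. k \<noteq> n + ?t)"
        assume w: "w \<in> carrier (mpoly_ring N)"
          "\<forall>k\<in>Poly_Mapping.keys w. k + ?t \<notin> S \<and> (k + ?t, a) \<in> r - Id"
        assume I: "p - scale_poly c ?q - v - w * f \<in> I"
        let ?v = "v + Poly_Mapping.single ?b c"
        have "scale_poly c ?q = Poly_Mapping.single ?b c"
          by (simp add: scale_poly_def const_poly_def monom_poly_def mult_single)
        with I have "p - ?v - w * f \<in> I" by (simp add: algebra_simps)
        moreover have "?v \<in> carrier (mpoly_ring N)"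
          using v(1) lp(3) by (intro carrier_closed single_in_carrier)
        moreover have "\<forall>k\<in>Poly_Mapping.keys ?v. k \<notin> S \<and> (\<forall>n\<in>monomials N. k \<noteq> n + ?t)"
        proof
          fix k assume "k \<in> Poly_Mapping.keys ?v"
          then have "k \<in> Poly_Mapping.keys v \<or> k = ?b"
            using keys_add[of v "Poly_Mapping.single ?b c"] by (auto split: if_splits)
          then show "k \<notin> S \<and> (\<forall>n\<in>monomials N. k \<noteq> n + ?t)"
          proof
            assume "k \<in> Poly_Mapping.keys v"
            with v(2) show ?thesis by (rule bspec)
          next
            assume "k = ?b"
            then show ?thesis using rest by simp
          qed
        qed
        ultimately show ?thesis using w by blast
      qed (use lp in \<open>auto simp: monom_poly_in_carrier lead_monom_monom_poly\<close>)
    qed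
  qed
qed

section \<open>Comparison through the colon ideal\<close>

text \<open>In the application \<open>S\<close> consists of the monomials of \<open>J\<close>. Then
  \<open>sum\<close> packages (T3) with the induction hypothesis for \<open>\<Phi>\<close>, and
  \<open>colon\<close> packages (T4) with the induction hypothesis for the colon ideal.\<close>

lemma lead_monoms_subset_if_colon:
  fixes I :: "('v, 'k::field) mpoly set"
  assumes I: "ideal I (mpoly_ring N)" and S: "S \<subseteq> lead_monoms r I"
    and S_add: "\<And>m n. m \<in> S \<Longrightarrow> n \<in> monomials N \<Longrightarrow> m + n \<in> S"
    and f: "f \<in> carrier (mpoly_ring N)" "f \<noteq> 0" "lead_monom r f \<noteq> 0"
    and sum: "\<And>g h. g \<in> I \<Longrightarrow> h \<in> carrier (mpoly_ring N) \<Longrightarrow> g + h * f \<noteq> 0 \<Longrightarrow>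
      lead_monom r (g + h * f) \<notin> S \<Longrightarrow>
      \<exists>n\<in>monomials N. lead_monom r (g + h * f) = n + lead_monom r f"
    and colon: "\<And>n. ideal_colon N I f \<noteq> I \<Longrightarrow> n \<in> lead_monoms r (ideal_colon N I f) \<Longrightarrow>
      n + lead_monom r f \<in> S"
  shows "lead_monoms r I \<subseteq> S"
proof (rule ccontr)
  let ?t = "lead_monom r f"
  note lf = lead_monom_greatest[OF f(1,2)]
  assume "\<not> lead_monoms r I \<subseteq> S"
  then obtain m where m: "m \<in> lead_monoms r I - S"
    and least: "\<And>k. (k, m) \<in> r - Id \<Longrightarrow> k \<notin> lead_monoms r I - S"
    using wfE_min[OF wf_strict_order, of _ "lead_monoms r I - S"] by blast
  then obtain g where g: "g \<in> I" "g \<noteq> 0" "lead_monom r g = m" unfolding lead_monoms_def by auto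
  have gc: "g \<in> carrier (mpoly_ring N)" using g(1) ideal_closed(1)[OF I] by blast
  \<comment> \<open>Since \<open>m\<close> is not in \<open>S\<close>, \<open>sum\<close> with
    \<open>h = 0\<close> makes it a multiple of \<open>?t\<close>.\<close>
  obtain n where n: "n \<in> monomials N" "m = n + ?t"
    using sum[of g 0] g m by (auto simp: mem_carrier_mpoly_ring)
  note q = monom_poly_times[OF f(1,2) n(1)]
  obtain c where c: "c \<noteq> 0" "g - scale_poly c (monom_poly n * f) \<in> carrier (mpoly_ring N)"
    "\<And>k. k \<in> Poly_Mapping.keys (g - scale_poly c (monom_poly n * f)) \<Longrightarrow> (k, m) \<in> r - Id"
    using lead_monom_cancel[OF gc g(2) q(3,2)] q(1) n(2) g(3) by metis
  have scale: "scale_poly c (monom_poly n * f) = Poly_Mapping.single n c * f"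
    by (simp add: scale_poly_def const_poly_def monom_poly_def mult_single flip: mult.assoc)
  obtain v w where v: "v \<in> carrier (mpoly_ring N)"
      "\<forall>k\<in>Poly_Mapping.keys v. k \<notin> S \<and> (\<forall>n\<in>monomials N. k \<noteq> n + ?t)"
    and w: "w \<in> carrier (mpoly_ring N)"
      "\<forall>k\<in>Poly_Mapping.keys w. k + ?t \<notin> S \<and> (k + ?t, m) \<in> r - Id"
    and rem: "g - scale_poly c (monom_poly n * f) - v - w * f \<in> I"
    using division_remainder[OF I S f(1,2) c(2), of m] c(3) by blast
  \<comment> \<open>\<open>u\<close> joins the quotient \<open>w\<close> and the multiple used to
    cancel \<open>m\<close>, so that \<open>v + u * f\<close> is congruent to \<open>g\<close>
    modulo \<open>I\<close>.\<close>
  define u where "u = w + Poly_Mapping.single n c"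
  have u: "u \<in> carrier (mpoly_ring N)"
    unfolding u_def using w(1) n(1) by (intro carrier_closed single_in_carrier)
  have "g - scale_poly c (monom_poly n * f) - v - w * f = g - (v + u * f)"
    unfolding scale u_def by (simp add: algebra_simps)
  with ideal_closed(5)[OF I g(1) rem] have vuf: "v + u * f \<in> I" by simp
  \<comment> \<open>Otherwise \<open>sum\<close>, applied to
    \<open>v = (v + u * f) + (- u) * f\<close>, puts the leading monomial of \<open>v\<close> in
    \<open>S\<close> or among the multiples of \<open>?t\<close>; the remainder has no such
    monomial.\<close>
  have "v = 0"
  proof (rule ccontr)
    assume v0: "v \<noteq> 0"
    have "- u \<in> carrier (mpoly_ring N)" using u by (simp add: mem_carrier_mpoly_ring)
    from sum[OF vuf this] v0
    have "lead_monom r v \<notin> S \<Longrightarrow> \<exists>n\<in>monomials N. lead_monom r v = n + ?t" by simp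
    then show False using v lead_monom_greatest(1)[OF v(1) v0] by blast
  qed
  with vuf have uI: "u \<in> ideal_colon N I f" using u by (simp add: ideal_colon_def mult.commute)
  \<comment> \<open>Monomials of \<open>w\<close> times \<open>?t\<close> are strictly below
    \<open>m = n + ?t\<close>, so the coefficient \<open>c\<close> at \<open>n\<close> cannot cancel
    in \<open>u\<close>.\<close>
  have "n \<notin> Poly_Mapping.keys w" using w(2) n(2) by auto
  then have "Poly_Mapping.lookup u n = c" by (simp add: u_def lookup_add in_keys_iff)
  then have u0: "u \<noteq> 0" using c(1) by auto
  define k where "k = lead_monom r u"
  have kN: "k \<in> monomials N" and "k \<in> Poly_Mapping.keys u"
    unfolding k_def using lead_monom_greatest[OF u u0] by blast+
  then have "k \<in> Poly_Mapping.keys w \<or> k = n"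
    using keys_add[of w "Poly_Mapping.single n c"] by (auto simp: u_def split: if_splits)
  then have kt: "k + ?t \<notin> S" "(k + ?t, m) \<in> r"
    using w(2) m n(2) order_refl[of m] n(1) lf(3) by auto
  have kL: "k \<in> lead_monoms r (ideal_colon N I f)"
    using uI u0 by (auto simp: lead_monoms_def k_def)
  show False
  proof (cases "ideal_colon N I f = I")
    case False
    then show False using colon kL kt(1) by blast
  next
    case True
    \<comment> \<open>Here \<open>?t\<close> differs from 1, so \<open>k\<close> is strictly below
      \<open>m\<close>. Minimality of \<open>m\<close> forces \<open>k\<close> into
      \<open>S\<close>, hence also \<open>k + ?t\<close>.\<close>
    have "(k, k + ?t) \<in> r - Id"
      using order_add[OF order_zero[OF lf(3)] kN] f(3) by (simp add: add.commute)
    then have "(k, m) \<in> r - Id"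
      using kt(2) order_trans order_antisym by (auto dest: transD antisymD)
    then have "k \<in> S" using least kL True by auto
    then show False using S_add lf(3) kt(1) by blast
  qed
qed

section \<open>Noetherian induction over the transition system\<close>

lemma lead_monoms_eq_monoms_in:
  fixes T :: "(('v, 'k::field) mpoly set \<times> ('v, 'k) mpoly set) set"
  assumes T: "transition_system N r T"
  shows "(I, J) \<in> T \<Longrightarrow> lead_monoms r I = monoms_in J"
proof (induction I arbitrary: J rule: wf_induct_rule[OF wf_ideal_supset])
  case (1 I)
  interpret R: cring "mpoly_ring N :: ('v, 'k) mpoly ring" by (rule cring_mpoly_ring)
  note I = transition_systemD(1)[OF T 1(2)] and J = transition_systemD(2,3)[OF T 1(2)]
  note J_iff = monomial_ideal_mem_iff[OF J(2)]
  have IH: "lead_monoms r P = monoms_in Q" if "(P, Q) \<in> T" "I \<subset> P" for P Q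
    using 1(1)[of P Q] that I transition_systemD(1)[OF T that(1)] by simp
  have S: "monoms_in J \<subseteq> lead_monoms r I"
  proof
    fix m assume "m \<in> monoms_in J"
    then have "monom_poly m \<in> init_ideal r I"
      using transition_systemD(4)[OF T 1(2)] by (auto simp: monoms_in_def)
    then show "m \<in> lead_monoms r I" by (simp add: init_ideal_mem_iff monom_poly_def)
  qed
  consider (max) "maximalideal I (mpoly_ring N)" | (eq) "I = J"
    | (step) "\<not> maximalideal I (mpoly_ring N)" "I \<noteq> J" by blast
  then have "lead_monoms r I \<subseteq> monoms_in J"
  proof cases
    case max
    then have "J = init_ideal r I" by (rule transition_systemD(5)[OF T 1(2)])
    then show ?thesis by (auto simp: monoms_in_def init_ideal_mem_iff monom_poly_def)
  next
    \<comment> \<open>A monomial ideal contains every monomial of its elements, in particular the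
      leading ones.\<close>
    case eq
    then show ?thesis
      using J_iff ideal_closed(1)[OF I] lead_monom_greatest(1) unfolding lead_monoms_def by blast
  next
    case step
    from transition_systemD(6)[OF T 1(2) step] obtain f \<Phi> where f: "f \<in> carrier (mpoly_ring N)" "f \<notin> range const_poly" "f \<notin> I"
      and \<Phi>: "\<Phi> \<subseteq> T"
      and T3: "I <+>\<^bsub>mpoly_ring N\<^esub> Idl\<^bsub>mpoly_ring N\<^esub> {f} \<subseteq> (\<Inter>(P, Q)\<in>\<Phi>. P)"
        "J <+>\<^bsub>mpoly_ring N\<^esub> Idl\<^bsub>mpoly_ring N\<^esub> {init r f} = (\<Inter>(P, Q)\<in>\<Phi>. Q)"
      and T4: "ideal_colon N I f \<noteq> I \<Longrightarrow>
             (ideal_colon N I f, ideal_colon N J (init r f)) \<in> T"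
      by (elim bexE exE conjE) blast
    have f0: "f \<noteq> 0" using f(3) ideal_closed(2)[OF I] by auto
    let ?t = "lead_monom r f"
    note lf = lead_monom_greatest[OF f(1) f0]
    \<comment> \<open>If the leading monomial were 1, all monomials of \<open>f\<close> would be 1
      and \<open>f\<close> would be constant.\<close>
    have t0: "?t \<noteq> 0"
    proof
      assume "?t = 0"
      then have "k = 0" if "k \<in> Poly_Mapping.keys f" for k
        using lf(2)[OF that] order_zero order_subset order_antisym by (auto dest: antisymD)
      then have "f = const_poly (Poly_Mapping.lookup f 0)"
        by (intro poly_mapping_eqI) (auto simp: const_poly_def lookup_single when_def in_keys_iff)
      then show False using f(2) by blast
    qed
    have init_f: "init r f = monom_poly ?t" using f0 by (simp add: init_eq_lead_monom)
    have Idl_f: "ideal (Idl\<^bsub>mpoly_ring N\<^esub> {f}) (mpoly_ring N)" "f \<in> Idl\<^bsub>mpoly_ring N\<^esub> {f}"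
      using f(1) by (auto intro: R.genideal_ideal R.genideal_self')
    have in_P: "g + h * f \<in> P"
      if "g \<in> I" "h \<in> carrier (mpoly_ring N)" "(P, Q) \<in> \<Phi>" for g h P Q
    proof -
      have "g + h * f \<in> I <+>\<^bsub>mpoly_ring N\<^esub> Idl\<^bsub>mpoly_ring N\<^esub> {f}"
        using that(1) ideal_closed(4)[OF Idl_f that(2)]
        by (auto simp: set_add_def' mpoly_ring_def)
      then show ?thesis using T3(1) that(3) by blast
    qed
    \<comment> \<open>The induction hypothesis applies because \<open>P\<close> contains
      \<open>I\<close> and also \<open>f\<close>, which is not in \<open>I\<close>.\<close>
    have lead_P: "lead_monoms r P = monoms_in Q" if "(P, Q) \<in> \<Phi>" for P Q
    proof (rule IH)
      show "(P, Q) \<in> T" using \<Phi> that by blast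
      have "I \<subseteq> P" using in_P[of _ 0, OF _ _ that] by (auto simp: mem_carrier_mpoly_ring)
      moreover have "f \<in> P"
        using in_P[of 0 1, OF _ _ that] ideal_closed(2)[OF I] by (auto simp: mem_carrier_mpoly_ring)
      ultimately show "I \<subset> P" using f(3) by blast
    qed
    show ?thesis
    proof (rule lead_monoms_subset_if_colon[OF I S _ f(1) f0 t0])
      fix m n assume "m \<in> monoms_in J" "n \<in> monomials N"
      then have "monom_poly n * monom_poly m \<in> J"
        by (intro ideal_closed(4)[OF J(1)]) (auto simp: monoms_in_def monom_poly_in_carrier)
      then show "m + n \<in> monoms_in J"
        by (simp add: monoms_in_def monom_poly_def mult_single add.commute)
    next
      fix g h :: "('v, 'k) mpoly"
      let ?x = "g + h * f"
      assume gh: "g \<in> I" "h \<in> carrier (mpoly_ring N)" "?x \<noteq> 0" "lead_monom r ?x \<notin> monoms_in J"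
      have "monom_poly (lead_monom r ?x) \<in> Q" if "(P, Q) \<in> \<Phi>" for P Q
      proof -
        have "lead_monom r ?x \<in> lead_monoms r P"
          using in_P[OF gh(1,2) that] gh(3) by (auto simp: lead_monoms_def)
        then show ?thesis using lead_P[OF that] by (simp add: monoms_in_def)
      qed
      then have "monom_poly (lead_monom r ?x) \<in>
        J <+>\<^bsub>mpoly_ring N\<^esub> Idl\<^bsub>mpoly_ring N\<^esub> {monom_poly ?t}"
        using T3(2) by (auto simp: init_f)
      moreover have "Idl\<^bsub>mpoly_ring N\<^esub> {monom_poly ?t :: ('v, 'k) mpoly} =
        {y * monom_poly ?t | y. y \<in> carrier (mpoly_ring N)}"
        using R.cgenideal_eq_genideal[of "monom_poly ?t"] lf(3)
        by (simp add: monom_poly_in_carrier cgenideal_def) (simp add: mpoly_ring_def)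
      ultimately obtain j y where jy: "j \<in> J" "y \<in> carrier (mpoly_ring N)"
        "monom_poly (lead_monom r ?x) = j + monom_poly ?t * y"
        by (auto simp: set_add_def' mult.commute) (auto simp: mpoly_ring_def)
      \<comment> \<open>The monomial occurs in \<open>j\<close> or in the multiple of
        \<open>?t\<close>. The first is impossible, as all monomials of \<open>j\<close> lie in the
        monomial ideal \<open>J\<close>.\<close>
      have "lead_monom r ?x \<in> Poly_Mapping.keys (j + monom_poly ?t * y)"
        unfolding jy(3)[symmetric] by (simp add: monom_poly_def)
      then have "lead_monom r ?x \<in> Poly_Mapping.keys (monom_poly ?t * y)"
        using keys_add[of j "monom_poly ?t * y"] jy(1) J_iff gh(4) by blast
      then show "\<exists>n\<in>monomials N. lead_monom r ?x = n + ?t"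
        using keys_single_times_subset[of ?t 1 y] jy(2)
        by (auto simp: monom_poly_def mem_carrier_mpoly_ring add.commute)
    next
      fix n assume colon: "ideal_colon N I f \<noteq> I" "n \<in> lead_monoms r (ideal_colon N I f)"
      have "I \<subseteq> ideal_colon N I f"
        using ideal_closed(1,4)[OF I] f(1) by (auto simp: ideal_colon_def)
      with colon(1) have "I \<subset> ideal_colon N I f" by blast
      \<comment> \<open>The induction hypothesis turns \<open>n\<close> into a monomial of the colon
        ideal of \<open>J\<close> by \<open>init r f\<close>.\<close>
      from IH[OF T4[OF colon(1)] this] colon(2)
      have "monom_poly ?t * monom_poly n \<in> J" by (simp add: monoms_in_def ideal_colon_def init_f)
      then show "n + ?t \<in> monoms_in J"
        by (simp add: monoms_in_def monom_poly_def mult_single add.commute)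
    qed
  qed
  with S show ?case by blast
qed

end

theorem theorem3p3:
  fixes N :: "'v set"
    and r :: "'v monomial rel"
    and T :: "(('v, 'k::alg_closed_field) mpoly set \<times> ('v, 'k) mpoly set) set"
  assumes "finite N"
    and "term_order N r"
    and "transition_system N r T"
  shows "\<forall>(I, J)\<in>T. init_ideal r I = J"
proof clarify
  interpret term_ordered N r using assms(1,2) by unfold_locales
  fix I J assume IJ: "(I, J) \<in> T"
  \<comment> \<open>Both ideals consist of all polynomials supported on one and the same set of
    monomials.\<close>
  show "init_ideal r I = J"
    using lead_monoms_eq_monoms_in[OF assms(3) IJ]
      monomial_ideal_mem_iff[OF transition_systemD(3)[OF assms(3) IJ]]
    by (auto simp: init_ideal_mem_iff)
qed

end
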